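(* For any integer $n\ge1$, $$[\mathbb{Z}_{2n}^-]\circledcirc[\mathrm{SO}(2)\oplus\mathbb{Z}_2^c]=\{[\mathbb{1}],[\mathbb{Z}_{2n}^-]\},\qquad [\mathbb{Z}_{2n}^-]\circledcirc[\mathrm{O}(2)\oplus\mathbb{Z}_2^c]=\{[\mathbb{1}],\mathcal{Z}(n),[\mathbb{Z}_{2n}^-]\},$$ where $\mathcal{Z}(n)=[\mathbb{Z}_2]$ if $n$ is even and $\mathcal{Z}(n)=[\mathbb{Z}_2^-]$ if $n$ is odd.
   Context: $[K]$ is the conjugacy class of a subgroup $K$ in $\mathrm{O}(3)$, and the clips operation is $[H_1]\circledcirc[H_2]=\{[H_1\cap gH_2g^{-1}]:g\in\mathrm{O}(3)\}$. $(e_1,e_2,e_3)$ is the canonical basis of $\mathbb{R}^3$, $\mathbf{r}(n,\theta)$ is the rotation by angle $\theta$ about the axis directed by $n\neq0$. $\mathbb{1}=\{\mathrm{Id}\}$; $\mathbb{Z}_2^c=\{\pm\mathrm{Id}\}$; $H\oplus\mathbb{Z}_2^c=H\cup(-H)$ for $H\subset\mathrm{SO}(3)$; $\mathbb{Z}_k=\{\mathbf{r}(e_3,2j\pi/k):0\le j\le k-1\}$, with $\mathbb{Z}_1=\mathbb{1}$; $\mathbb{Z}_{2k}^-=\mathbb{Z}_k\cup(-\mathbf{r}(e_3,\pi/k))\mathbb{Z}_k$ for $k\ge1$. Here $\mathrm{SO}(2)=\{\mathbf{r}(e_3,\theta):\theta\in[0,2\pi]\}$ and $\mathrm{O}(2)=\mathrm{SO}(2)\cup\{\mathbf{r}(b,\pi):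 b\ne0 \text{ in the } (xy)\text{-plane}\}$, as subgroups of $\mathrm{SO}(3)$. *)

theory Defs
  imports "HOL-Analysis.Analysis"
begin

definition O3 :: "(real^3^3) set"
  where "O3 = {A. orthogonal_matrix A}"

text \<open>Subgroups of O(3) are represented by their sets of matrices.\<close>

definition conj_by :: "real^3^3 \<Rightarrow> (real^3^3) set \<Rightarrow> (real^3^3) set"
  where "conj_by g K = (\<lambda>A. g ** A ** matrix_inv g) ` K"

definition conj_class :: "(real^3^3) set \<Rightarrow> (real^3^3) set set"
  where "conj_class K = {conj_by g K | g. g \<in> O3}"

text \<open>The clips operation acts on conjugacy classes. It is defined here without choosing
  representatives; the usual formula in terms of chosen representatives is \<open>clips_conj_class\<close> below.\<close>

definition clips :: "(real^3^3) set set \<Rightarrow> (real^3^3) set set \<Rightarrow> (real^3^3) set set set"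
    (infixl "\<circledcirc>" 70)
  where "C1 \<circledcirc> C2 = {conj_class (H1 \<inter> conj_by g H2) | H1 H2 g. H1 \<in> C1 \<and> H2 \<in> C2 \<and> g \<in> O3}"

lemma O3_mult: "g \<in> O3 \<Longrightarrow> h \<in> O3 \<Longrightarrow> g ** h \<in> O3"
  by (simp add: O3_def orthogonal_matrix_mul)

lemma O3_matrix_inv: "g \<in> O3 \<Longrightarrow> matrix_inv g = transpose g"
proof -
  assume "g \<in> O3"
  then have g: "g ** transpose g = mat 1" "transpose g ** g = mat 1"
    by (simp_all add: O3_def orthogonal_matrix_def)
  then have "g ** matrix_inv g = mat 1 \<and> matrix_inv g ** g = mat 1"
    unfolding matrix_inv_def by (intro someI) blast
  then have "(transpose g ** g) ** matrix_inv g = transpose g"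
    by (simp flip: matrix_mul_assoc)
  then show ?thesis
    using g by simp
qed

lemma O3_transpose: "g \<in> O3 \<Longrightarrow> transpose g \<in> O3"
  by (simp add: O3_def)

lemma mat_1_O3: "mat 1 \<in> O3"
  by (simp add: O3_def orthogonal_matrix_id)

lemma conj_by_conj_by:
  assumes "g \<in> O3" "h \<in> O3"
  shows "conj_by g (conj_by h K) = conj_by (g ** h) K"
  using assms
  by (simp add: conj_by_def image_image O3_mult O3_matrix_inv matrix_transpose_mul matrix_mul_assoc)

lemma conj_by_mat_1: "conj_by (mat 1) K = K"
  by (simp add: conj_by_def O3_matrix_inv[OF mat_1_O3] transpose_mat)

lemma conj_by_Int:
  assumes "g \<in> O3"
  shows "conj_by g (K \<inter> L) = conj_by g K \<inter> conj_by g L"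
proof -
  have inv: "transpose g ** (g ** A ** transpose g) ** g = A" for A
    using assms by (simp add: O3_def orthogonal_matrix_def matrix_mul_assoc)
      (simp flip: matrix_mul_assoc)
  have "inj (\<lambda>A. g ** A ** transpose g)"
    by (rule inj_on_inverseI[where g = "\<lambda>B. transpose g ** B ** g"]) (rule inv)
  then show ?thesis
    by (simp add: conj_by_def O3_matrix_inv[OF assms] image_Int)
qed

lemma conj_class_conj_by:
  assumes "g \<in> O3"
  shows "conj_class (conj_by g K) = conj_class K"
proof
  show "conj_class (conj_by g K) \<subseteq> conj_class K"
    using assms by (auto simp: conj_class_def conj_by_conj_by intro: O3_mult)
  show "conj_class K \<subseteq> conj_class (conj_by g K)"
  proof
    fix X assume "X \<in> conj_class K"
    then obtain h where h: "h \<in> O3" "X = conj_by h K"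
      by (auto simp: conj_class_def)
    have "h ** transpose g ** g = h"
      using assms by (simp add: O3_def orthogonal_matrix_def flip: matrix_mul_assoc)
    then have "X = conj_by (h ** transpose g) (conj_by g K)"
      using assms h by (simp add: conj_by_conj_by O3_mult O3_transpose)
    then show "X \<in> conj_class (conj_by g K)"
      using assms h by (auto simp: conj_class_def intro: O3_mult O3_transpose)
  qed
qed

lemma clips_conj_class:
  "conj_class H1 \<circledcirc> conj_class H2 = {conj_class (H1 \<inter> conj_by g H2) | g. g \<in> O3}"
proof
  show "{conj_class (H1 \<inter> conj_by g H2) | g. g \<in> O3} \<subseteq> conj_class H1 \<circledcirc> conj_class H2"
  proof -
    have "H \<in> conj_class H" for H
      unfolding conj_class_def using mat_1_O3 conj_by_mat_1[of H] by force
    then show ?thesis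
      unfolding clips_def by blast
  qed
  show "conj_class H1 \<circledcirc> conj_class H2 \<subseteq> {conj_class (H1 \<inter> conj_by g H2) | g. g \<in> O3}"
  proof
    fix C assume "C \<in> conj_class H1 \<circledcirc> conj_class H2"
    then obtain a b g where abg: "a \<in> O3" "b \<in> O3" "g \<in> O3"
      and C: "C = conj_class (conj_by a H1 \<inter> conj_by g (conj_by b H2))"
      unfolding clips_def conj_class_def by blast
    let ?h = "transpose a ** g ** b"
    have h: "?h \<in> O3"
      using abg by (intro O3_mult O3_transpose)
    have "a ** ?h = g ** b"
      using abg by (simp add: O3_def orthogonal_matrix_def matrix_mul_assoc)
    then have "conj_by a H1 \<inter> conj_by g (conj_by b H2) = conj_by a (H1 \<inter> conj_by ?h H2)"
      using abg h by (simp add: conj_by_Int conj_by_conj_by)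
    then have "C = conj_class (H1 \<inter> conj_by ?h H2)"
      using C abg conj_class_conj_by by simp
    then show "C \<in> {conj_class (H1 \<inter> conj_by g H2) | g. g \<in> O3}"
      using h by blast
  qed
qed

text \<open>Rodrigues' formula for the rotation by the angle \<open>\<theta>\<close>, counterclockwise about the axis directed
  by \<open>n\<close>. It is only meaningful for \<open>n \<noteq> 0\<close>.\<close>

definition rot :: "real^3 \<Rightarrow> real \<Rightarrow> real^3^3"
  where "rot n \<theta> = (let u = n /\<^sub>R norm n in
    matrix (\<lambda>v. cos \<theta> *\<^sub>R v + sin \<theta> *\<^sub>R cross3 u v + ((1 - cos \<theta>) * (u \<bullet> v)) *\<^sub>R u))"

abbreviation e3 :: "real^3"
  where "e3 \<equiv> axis 3 1"

lemma rot_e3: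
  "rot e3 \<theta> = vector [vector [cos \<theta>, - sin \<theta>, 0], vector [sin \<theta>, cos \<theta>, 0], vector [0, 0, 1]]"
proof -
  have "norm e3 = 1"
    by (simp add: norm_axis_1)
  then show ?thesis
    by (simp add: rot_def matrix_def cross3_def vec_eq_iff forall_3 inner_axis')
      (simp add: axis_def)
qed

definition trivial_group :: "(real^3^3) set"
  where "trivial_group = {mat 1}"

text \<open>\<open>H \<oplus> {mat 1, - mat 1}\<close>, for \<open>H\<close> a subgroup of SO(3).\<close>

definition plus_Zc2 :: "(real^3^3) set \<Rightarrow> (real^3^3) set"
  where "plus_Zc2 H = H \<union> uminus ` H"

definition Zrot :: "nat \<Rightarrow> (real^3^3) set"
  where "Zrot k = {rot e3 (2 * real j * pi / real k) | j. j < k}"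

text \<open>The argument is half the order: \<open>Zminus k\<close> is the group of order \<open>2 * k\<close> usually written
  with the index \<open>2 * k\<close>, so that the group with index 2 is \<open>Zminus 1\<close>.\<close>

definition Zminus :: "nat \<Rightarrow> (real^3^3) set"
  where "Zminus k = Zrot k \<union> (\<lambda>A. (- rot e3 (pi / real k)) ** A) ` Zrot k"

definition SO2 :: "(real^3^3) set"
  where "SO2 = {rot e3 \<theta> | \<theta>. \<theta> \<in> {0..2 * pi}}"

definition O2 :: "(real^3^3) set"
  where "O2 = SO2 \<union> {rot b pi | b. b \<noteq> 0 \<and> b $ 3 = 0}"

definition Zcal :: "nat \<Rightarrow> (real^3^3) set set"
  where "Zcal n = (if even n then conj_class (Zrot 2) else conj_class (Zminus 1))"

end

theory Submission
  imports Defs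
begin

text \<open>Adjoining \<open>- mat 1\<close> turns both continuous groups into groups described by their action on the
  axis \<open>e3\<close>: \<open>plus_Zc2 O2\<close> consists of the orthogonal matrices that map \<open>e3\<close> to \<open>e3\<close> or \<open>- e3\<close>, and
  \<open>plus_Zc2 SO2\<close> of those that map \<open>e3\<close> to \<open>det A *\<^sub>R e3\<close> (\<open>plus_Zc2_O2_eq\<close>, \<open>plus_Zc2_SO2_eq\<close>).
  Conjugating by \<open>g\<close> only replaces \<open>e3\<close> by \<open>a = g *v e3\<close>, which can be any unit vector. So each
  intersection consists of the elements of \<open>Zminus n\<close> for which \<open>a\<close> is an eigenvector with eigenvalue
  \<open>1\<close> or \<open>- 1\<close>, in the case of \<open>SO2\<close> with the eigenvalue prescribed by the determinant.

  The group \<open>Zminus n\<close> is cyclic of order \<open>2 * n\<close>: its elements are the powers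
  \<open>(- 1) ^ k *\<^sub>R rot e3 (k * pi / n)\<close>, \<open>k < 2 * n\<close>, of one rotoreflection (\<open>Zminus_eq\<close>). A rotation about
  \<open>e3\<close> fixes a vector off its axis only if its angle is a full turn, and reverses a nonzero vector only
  if it is a half-turn and the vector is horizontal (\<open>rot_e3_eigenvector_iff\<close>). Among the angles
  \<open>k * pi / n\<close> these are \<open>k = 0\<close> and \<open>k = n\<close>. Hence there are three cases: if \<open>a\<close> is vertical, the whole
  group survives; if \<open>a\<close> is horizontal, the powers \<open>0\<close> and \<open>n\<close> survive in the case of \<open>O2\<close>, but only
  the power \<open>0\<close> in the case of \<open>SO2\<close>; for every other \<open>a\<close> only the identity does.
  The \<open>n\<close>-th power is \<open>(- 1) ^ n *\<^sub>R rot e3 pi\<close>, a half-turn for even \<open>n\<close> and the reflection in the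
  horizontal plane for odd \<open>n\<close>; this is where the parity in \<open>Zcal\<close> comes from.\<close>

section \<open>Stabilisers of the vertical axis\<close>

text \<open>The entries of \<open>transpose A ** A = mat 1\<close>, with the sums written out so that identities between
  entries can be left to polynomial arithmetic.\<close>

lemma orthogonal_matrix_3_iff:
  fixes A :: "real^3^3"
  shows "orthogonal_matrix A \<longleftrightarrow>
    (\<forall>i j. A$1$i * A$1$j + A$2$i * A$2$j + A$3$i * A$3$j = (if i = j then 1 else 0))"
  unfolding orthogonal_matrix
  by (simp add: vec_eq_iff matrix_matrix_mult_def transpose_def mat_def sum_3)

lemma rot_e3_nth:
  "rot e3 t $ 1 $ 1 = cos t" "rot e3 t $ 1 $ 2 = - sin t" "rot e3 t $ 1 $ 3 = 0"
  "rot e3 t $ 2 $ 1 = sin t" "rot e3 t $ 2 $ 2 = cos t" "rot e3 t $ 2 $ 3 = 0"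
  "rot e3 t $ 3 $ 1 = 0" "rot e3 t $ 3 $ 2 = 0" "rot e3 t $ 3 $ 3 = 1"
  by (simp_all add: rot_e3)

lemma rot_e3_O3: "rot e3 t \<in> O3"
  by (simp add: O3_def orthogonal_matrix_3_iff forall_3 rot_e3_nth flip: power2_eq_square)

lemma det_rot_e3: "det (rot e3 t) = 1"
  by (simp add: det_3 rot_e3_nth flip: power2_eq_square)

lemma rot_e3_add: "rot e3 s ** rot e3 t = rot e3 (s + t)"
  by (simp add: vec_eq_iff matrix_matrix_mult_def sum_3 forall_3 rot_e3_nth cos_add sin_add algebra_simps)

lemma uminus_O3: "- A \<in> O3 \<longleftrightarrow> A \<in> O3"
  by (simp add: O3_def orthogonal_matrix_3_iff)

lemma det_uminus_3: "det (- A) = - det (A :: real^3^3)"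
  by (simp add: det_3 algebra_simps)

lemma uminus_matrix_vector: "(- A) *v x = - (A *v (x :: real^3))" for A :: "real^3^3"
  by (simp add: vec_eq_iff matrix_vector_mult_def sum_negf)

lemma matrix_vector_e3: "A *v e3 = (\<chi> i. A $ i $ 3)" for A :: "real^3^3"
  by (simp add: vec_eq_iff matrix_vector_mult_def axis_def if_distrib cong: if_cong)

text \<open>At the angle \<open>pi\<close>, Rodrigues' formula loses its cross product: a half-turn about the unit vector
  \<open>u\<close> is \<open>v \<mapsto> 2 (u \<bullet> v) u - v\<close>.\<close>

lemma rot_pi_nth:
  "rot b pi $ i $ j = 2 * (b /\<^sub>R norm b) $ i * (b /\<^sub>R norm b) $ j - (if i = j then 1 else 0)"
proof -
  define u where "u = b /\<^sub>R norm b"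
  have "rot b pi = matrix (\<lambda>v. - v + (2 * (u \<bullet> v)) *\<^sub>R u)"
    by (simp add: rot_def u_def Let_def)
  then show ?thesis
    unfolding u_def[symmetric] by (simp add: matrix_def inner_axis) (simp add: axis_def)
qed

lemma half_turn_horizontal:
  fixes b :: "real^3"
  assumes b: "b \<noteq> 0" "b $ 3 = 0"
  shows "rot b pi \<in> O3" and "rot b pi *v e3 = - e3"
proof -
  define u where "u = b /\<^sub>R norm b"
  have u: "norm u = 1" "u $ 3 = 0"
    using b by (simp_all add: u_def)
  then have sq: "u$1 * u$1 + u$2 * u$2 = 1"
    by (simp add: norm_eq_1 inner_vec_def sum_3)
  note nth = rot_pi_nth[of b, folded u_def]
  show "rot b pi \<in> O3"
    unfolding O3_def orthogonal_matrix_3_iff forall_3 nth mem_Collect_eq using sq u(2)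
    by simp (intro conjI; algebra)
  show "rot b pi *v e3 = - e3"
    unfolding matrix_vector_e3 by (simp add: vec_eq_iff nth u(2) axis_def)
qed

text \<open>An orthogonal matrix that fixes \<open>e3\<close> acts on the horizontal plane as an orthogonal 2-by-2 matrix,
  so it is either a rotation about \<open>e3\<close> or the reflection in a vertical plane. The latter is the
  negative of the half-turn about the horizontal normal \<open>b\<close> of that plane.\<close>

lemma O3_fixing_e3:
  assumes "A \<in> O3" and "A *v e3 = e3"
  shows "A \<in> SO2 \<and> det A = 1
    \<or> (\<exists>b. b \<noteq> 0 \<and> b $ 3 = 0 \<and> A = - rot b pi) \<and> det A = - 1"
proof -
  have col: "A$1$3 = 0" "A$2$3 = 0" "A$3$3 = 1"
    using assms(2) unfolding matrix_vector_e3 by (simp_all add: vec_eq_iff forall_3 axis_def)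
  have orth: "A$1$i * A$1$j + A$2$i * A$2$j + A$3$i * A$3$j = (if i = j then 1 else 0)" for i j
    using assms(1) by (simp add: O3_def orthogonal_matrix_3_iff)
  have row: "A$3$1 = 0" "A$3$2 = 0"
    using orth[of 1 3] orth[of 2 3] col by simp_all
  have n1: "(A$1$1)\<^sup>2 + (A$2$1)\<^sup>2 = 1" and n2: "(A$1$2)\<^sup>2 + (A$2$2)\<^sup>2 = 1"
    and o: "A$1$1 * A$1$2 + A$2$1 * A$2$2 = 0"
    using orth[of 1 1] orth[of 2 2] orth[of 1 2] row by (simp_all add: power2_eq_square)
  obtain t where t: "0 \<le> t" "t < 2 * pi" "A$1$1 = cos t" "A$2$1 = sin t"
    using sincos_total_2pi[OF n1] by blast
  define d where "d = det A"
  have d: "d = A$1$1 * A$2$2 - A$1$2 * A$2$1"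
    by (simp add: d_def det_3 col row)
  have "d\<^sup>2 = 1"
    using n1 n2 o unfolding d by algebra
  then have "d = 1 \<or> d = - 1"
    by (simp add: power2_eq_1_iff)
  moreover have c: "A$1$2 = - d * sin t" "A$2$2 = d * cos t"
    using n1 o unfolding d t(3,4)[symmetric] by algebra+
  moreover have "A \<in> SO2" if "d = 1"
  proof -
    have "A = rot e3 t"
      using that by (simp add: vec_eq_iff forall_3 rot_e3_nth t col row c)
    then show ?thesis
      using t by (auto simp: SO2_def)
  qed
  moreover have "\<exists>b. b \<noteq> 0 \<and> b $ 3 = 0 \<and> A = - rot b pi" if "d = - 1"
  proof -
    \<comment> \<open>The upper left block is the reflection \<open>((cos t, sin t), (sin t, - cos t))\<close>, whose mirror line
      makes the angle \<open>t / 2\<close> with the first axis; \<open>b\<close> is normal to that line.\<close>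
    define b :: "real^3" where "b = vector [- sin (t / 2), cos (t / 2), 0]"
    have nb: "norm b = 1"
      by (simp add: norm_eq_1 inner_vec_def sum_3 b_def flip: power2_eq_square)
    have b: "b$1 = - sin (t / 2)" "b$2 = cos (t / 2)" "b$3 = 0"
      by (simp_all add: b_def)
    have "cos t = 1 - 2 * (sin (t / 2))\<^sup>2" "cos t = 2 * (cos (t / 2))\<^sup>2 - 1"
      "sin t = 2 * sin (t / 2) * cos (t / 2)"
      using cos_double_sin[of "t / 2"] cos_double_cos[of "t / 2"] sin_double[of "t / 2"]
      by simp_all
    then have "rot b pi $ 1 $ 1 = - cos t" "rot b pi $ 1 $ 2 = - sin t"
      "rot b pi $ 2 $ 1 = - sin t" "rot b pi $ 2 $ 2 = cos t"
      by (simp_all only: rot_pi_nth nb b inverse_1 scaleR_one) (simp_all add: power2_eq_square)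
    moreover have "rot b pi $ 1 $ 3 = 0" "rot b pi $ 2 $ 3 = 0"
      "rot b pi $ 3 $ 1 = 0" "rot b pi $ 3 $ 2 = 0" "rot b pi $ 3 $ 3 = - 1"
      by (simp_all add: rot_pi_nth b)
    ultimately have "A = - rot b pi"
      using that by (simp add: vec_eq_iff forall_3 t col row c)
    moreover have "b \<noteq> 0" "b $ 3 = 0"
      using nb by (auto simp: b_def)
    ultimately show ?thesis
      by blast
  qed
  ultimately show ?thesis
    by (auto simp: d_def)
qed

lemma SO2_props:
  assumes "A \<in> SO2"
  shows "A \<in> O3" "A *v e3 = e3" "det A = 1"
proof -
  obtain t where A: "A = rot e3 t"
    using assms by (auto simp: SO2_def)
  show "A \<in> O3" "det A = 1"
    by (simp_all add: A rot_e3_O3 det_rot_e3)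
  show "A *v e3 = e3"
    unfolding matrix_vector_e3 A
    by (simp add: vec_eq_iff forall_3 rot_e3) (simp add: axis_def)
qed

lemma mem_plus_Zc2_iff: "A \<in> plus_Zc2 H \<longleftrightarrow> A \<in> H \<or> - A \<in> H"
  unfolding plus_Zc2_def by (metis Un_iff image_iff minus_minus)

text \<open>Rotations about \<open>e3\<close> fix it and half-turns about horizontal axes reverse it, which gives one
  inclusion in each of the two descriptions below. Conversely, one of \<open>A\<close> and \<open>- A\<close> fixes \<open>e3\<close>,
  and \<open>O3_fixing_e3\<close> classifies it; for \<open>SO2\<close>, the determinant condition says that this one is a proper rotation.\<close>

lemma plus_Zc2_O2_eq: "plus_Zc2 O2 = {A \<in> O3. A *v e3 = e3 \<or> A *v e3 = - e3}"
proof (intro set_eqI iffI)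
  have *: "A \<in> O3 \<and> (A *v e3 = e3 \<or> A *v e3 = - e3)" if "A \<in> O2" for A
    using that SO2_props half_turn_horizontal by (auto simp: O2_def)
  fix A
  show "A \<in> {A \<in> O3. A *v e3 = e3 \<or> A *v e3 = - e3}" if "A \<in> plus_Zc2 O2"
    using that *[of A] *[of "- A"]
    by (auto simp: mem_plus_Zc2_iff uminus_O3 uminus_matrix_vector minus_equation_iff[of "A *v e3"])
  have **: "A \<in> plus_Zc2 O2" if "A \<in> O3" "A *v e3 = e3" for A
    using O3_fixing_e3[OF that] by (auto simp: mem_plus_Zc2_iff O2_def)
  show "A \<in> plus_Zc2 O2" if "A \<in> {A \<in> O3. A *v e3 = e3 \<or> A *v e3 = - e3}"
    using that **[of A] **[of "- A"]
    by (auto simp: uminus_O3 uminus_matrix_vector mem_plus_Zc2_iff)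
qed

lemma plus_Zc2_SO2_eq: "plus_Zc2 SO2 = {A \<in> O3. A *v e3 = det A *\<^sub>R e3}"
proof (intro set_eqI iffI)
  fix A
  show "A \<in> {A \<in> O3. A *v e3 = det A *\<^sub>R e3}" if "A \<in> plus_Zc2 SO2"
    using that SO2_props[of A] SO2_props[of "- A"]
    by (auto simp: mem_plus_Zc2_iff uminus_O3 uminus_matrix_vector det_uminus_3
        minus_equation_iff[of "A *v e3"] minus_equation_iff[of "det A"])
  assume "A \<in> {A \<in> O3. A *v e3 = det A *\<^sub>R e3}"
  then have A: "A \<in> O3" "A *v e3 = det A *\<^sub>R e3"
    by simp_all
  then have "det A = 1 \<or> det A = - 1"
    using det_orthogonal_matrix by (auto simp: O3_def)
  then show "A \<in> plus_Zc2 SO2"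
  proof
    assume "det A = 1"
    then show ?thesis
      using A O3_fixing_e3[of A] by (auto simp: mem_plus_Zc2_iff)
  next
    assume "det A = - 1"
    then show ?thesis
      using A O3_fixing_e3[of "- A"]
      by (auto simp: mem_plus_Zc2_iff uminus_O3 uminus_matrix_vector det_uminus_3)
  qed
qed

lemma mem_conj_by_iff:
  assumes "g \<in> O3"
  shows "A \<in> conj_by g K \<longleftrightarrow> transpose g ** A ** g \<in> K"
proof
  have g: "transpose g ** g = mat 1" "g ** transpose g = mat 1"
    using assms by (simp_all add: O3_def orthogonal_matrix_def)
  show "transpose g ** A ** g \<in> K" if A: "A \<in> conj_by g K"
  proof -
    obtain B where B: "B \<in> K" "A = g ** B ** transpose g"
      using A unfolding conj_by_def O3_matrix_inv[OF assms] by blast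
    have "transpose g ** A ** g = (transpose g ** g) ** B ** (transpose g ** g)"
      by (simp add: B matrix_mul_assoc)
    then show ?thesis
      by (simp add: g B)
  qed
  show "A \<in> conj_by g K" if "transpose g ** A ** g \<in> K"
  proof -
    have "g ** (transpose g ** A ** g) ** transpose g = (g ** transpose g) ** A ** (g ** transpose g)"
      by (simp add: matrix_mul_assoc)
    then have "A = g ** (transpose g ** A ** g) ** transpose g"
      by (simp add: g)
    then show ?thesis
      using that unfolding conj_by_def O3_matrix_inv[OF assms] by blast
  qed
qed

text \<open>This is how conjugation by \<open>g\<close> moves the axis \<open>e3\<close> to \<open>g *v e3\<close>.\<close>

lemma conj_eigenvector_iff:
  fixes g A :: "real^3^3"
  assumes "g \<in> O3"
  shows "(transpose g ** A ** g) *v x = c *\<^sub>R x \<longleftrightarrow> A *v (g *v x) = c *\<^sub>R (g *v x)"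
proof -
  have g: "transpose g ** g = mat 1" "g ** transpose g = mat 1"
    using assms by (simp_all add: O3_def orthogonal_matrix_def)
  have "(transpose g ** A ** g) *v x = transpose g *v (A *v (g *v x))"
    by (simp add: matrix_vector_mul_assoc matrix_mul_assoc)
  moreover have "transpose g *v y = z \<longleftrightarrow> y = g *v z" for y z
    using g by (metis matrix_vector_mul_assoc matrix_vector_mul_lid)
  ultimately show ?thesis
    by (simp add: matrix_vector_mult_scaleR)
qed

lemma conj_O3_iff:
  assumes "g \<in> O3"
  shows "transpose g ** A ** g \<in> O3 \<longleftrightarrow> A \<in> O3"
proof
  have "conj_by g O3 = O3"
  proof -
    have "conj_by h O3 \<subseteq> O3" if "h \<in> O3" for h
      using that by (auto simp: conj_by_def O3_matrix_inv O3_mult O3_transpose)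
    then show ?thesis
      using assms by (auto simp: mem_conj_by_iff O3_mult O3_transpose)
  qed
  then show "transpose g ** A ** g \<in> O3 \<Longrightarrow> A \<in> O3" "A \<in> O3 \<Longrightarrow> transpose g ** A ** g \<in> O3"
    using mem_conj_by_iff[OF assms, of A O3] by simp_all
qed

lemma conj_plus_Zc2_O2_eq:
  assumes "g \<in> O3"
  shows "conj_by g (plus_Zc2 O2) = {A \<in> O3. A *v (g *v e3) = g *v e3 \<or> A *v (g *v e3) = - (g *v e3)}"
  using conj_eigenvector_iff[OF assms, of _ e3 1] conj_eigenvector_iff[OF assms, of _ e3 "-1"]
  by (simp add: set_eq_iff mem_conj_by_iff[OF assms] plus_Zc2_O2_eq conj_O3_iff[OF assms])

lemma conj_plus_Zc2_SO2_eq: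
  assumes "g \<in> O3"
  shows "conj_by g (plus_Zc2 SO2) = {A \<in> O3. A *v (g *v e3) = det A *\<^sub>R (g *v e3)}"
proof -
  have "det g * det g = 1"
    using assms det_orthogonal_matrix[of g] by (auto simp: O3_def)
  then have "det (transpose g ** A ** g) = det A" for A
    by (simp add: det_mul det_transpose algebra_simps)
  then show ?thesis
    by (simp add: set_eq_iff mem_conj_by_iff[OF assms] plus_Zc2_SO2_eq conj_O3_iff[OF assms]
        conj_eigenvector_iff[OF assms])
qed

section \<open>The cyclic group generated by a rotoreflection\<close>

text \<open>The \<open>k\<close>-th power of \<open>- rot e3 (pi / n)\<close>, written in closed form so that its angle and its sign can
  be read off.\<close>

definition rotoreflection_power :: "nat \<Rightarrow> nat \<Rightarrow> real^3^3"
  where "rotoreflection_power n k = (- 1) ^ k *\<^sub>R rot e3 (real k * pi / real n)"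

text \<open>The even powers form the rotation subgroup \<open>Zrot n\<close>, the odd ones its other coset.\<close>

lemma Zminus_eq:
  assumes "n \<ge> 1"
  shows "Zminus n = rotoreflection_power n ` {..<2 * n}"
proof -
  have even: "rotoreflection_power n (2 * j) = rot e3 (2 * real j * pi / real n)" for j
    by (simp add: rotoreflection_power_def)
  have "rot e3 (pi / real n) ** rot e3 (2 * real j * pi / real n)
      = rot e3 (real (2 * j + 1) * pi / real n)" for j
    by (simp add: rot_e3_add add_divide_distrib algebra_simps)
  moreover have "(- A) ** B = - (A ** B)" for A B :: "real^3^3"
    by (simp add: vec_eq_iff matrix_matrix_mult_def sum_negf)
  ultimately have odd: "rotoreflection_power n (2 * j + 1)
      = (- rot e3 (pi / real n)) ** rot e3 (2 * real j * pi / real n)" for j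
    by (simp add: rotoreflection_power_def)
  have "{..<2 * n} = (\<lambda>j. 2 * j) ` {..<n} \<union> (\<lambda>j. 2 * j + 1) ` {..<n}"
  proof -
    have "k \<in> (\<lambda>j. 2 * j) ` {..<n} \<union> (\<lambda>j. 2 * j + 1) ` {..<n}" if "k < 2 * n" for k
      using that by (cases "even k") (auto elim!: evenE oddE)
    then show ?thesis by auto
  qed
  then show ?thesis
    unfolding Zminus_def Zrot_def using even odd by (auto simp: image_Un image_image)
qed

lemma Zminus_subset_O3: "n \<ge> 1 \<Longrightarrow> Zminus n \<subseteq> O3"
  by (auto simp: Zminus_eq rotoreflection_power_def minus_one_power_iff uminus_O3 rot_e3_O3)

lemma cos_eq_1_angle_iff:
  assumes "n \<ge> 1" "k < 2 * n"
  shows "cos (real k * pi / real n) = 1 \<longleftrightarrow> k = 0"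
proof
  assume "cos (real k * pi / real n) = 1"
  then obtain i :: int where "real k * pi / real n = i * 2 * pi"
    by (auto simp: cos_one_2pi_int)
  then have "real k = real_of_int (2 * i * int n)"
    using assms(1) by (simp add: field_simps)
  then have i: "int k = (2 * i) * int n"
    by linarith
  then have "0 \<le> (2 * i) * int n" "(2 * i) * int n < 2 * int n"
    using assms(2) by linarith+
  then have "0 \<le> 2 * i" "2 * i < 2"
    using assms(1) by (simp_all add: zero_le_mult_iff mult_less_cancel_right)
  then have "i = 0"
    by linarith
  then show "k = 0"
    using i by simp
qed simp

lemma cos_eq_minus1_angle_iff:
  assumes "n \<ge> 1" "k < 2 * n"
  shows "cos (real k * pi / real n) = - 1 \<longleftrightarrow> k = n"
proof
  assume "cos (real k * pi / real n) = - 1"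
  then obtain i :: int where "real k * pi / real n = (2 * i + 1) * pi"
    by (auto simp: cos_eq_minus1)
  then have "real k / real n = 2 * i + 1"
    by (simp only: times_divide_eq_left[symmetric] mult_cancel_right) simp
  then have "real k = real_of_int ((2 * i + 1) * int n)"
    using assms(1) by (simp add: field_simps)
  then have i: "int k = (2 * i + 1) * int n"
    by linarith
  then have "0 \<le> (2 * i + 1) * int n" "(2 * i + 1) * int n < 2 * int n"
    using assms(2) by linarith+
  then have "0 \<le> 2 * i + 1" "2 * i + 1 < 2"
    using assms(1) by (simp_all add: zero_le_mult_iff mult_less_cancel_right)
  then have "i = 0"
    by linarith
  then show "k = n"
    using i by simp
qed (use assms in simp)

text \<open>In the horizontal plane a rotation by \<open>t\<close> has the complex eigenvalues \<open>cos t \<plusminus> \<i> sin t\<close>, so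
  they are real only if \<open>sin t = 0\<close>, and then every horizontal vector belongs to \<open>cos t\<close>;
  along \<open>e3\<close> the eigenvalue is \<open>1\<close>.\<close>

lemma rot_e3_eigenvector_iff:
  assumes e: "e\<^sup>2 = 1"
  shows "rot e3 t *v a = e *\<^sub>R a \<longleftrightarrow> (cos t = e \<or> a$1 = 0 \<and> a$2 = 0) \<and> (e = 1 \<or> a$3 = 0)"
proof -
  have sc: "(sin t)\<^sup>2 + (cos t)\<^sup>2 = 1"
    by simp
  have eq: "rot e3 t *v a = e *\<^sub>R a \<longleftrightarrow>
      cos t * a$1 - sin t * a$2 = e * a$1 \<and> sin t * a$1 + cos t * a$2 = e * a$2
      \<and> (e = 1 \<or> a$3 = 0)"
    by (auto simp: vec_eq_iff matrix_vector_mult_def sum_3 forall_3 rot_e3_nth)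
  show ?thesis
  proof
    assume L: "rot e3 t *v a = e *\<^sub>R a"
    then have E: "cos t * a$1 - sin t * a$2 = e * a$1" "sin t * a$1 + cos t * a$2 = e * a$2"
      by (simp_all add: eq)
    \<comment> \<open>\<open>2 * e * (e - cos t) = (e - cos t)\<^sup>2 + (sin t)\<^sup>2\<close> is, because \<open>e\<^sup>2 = 1\<close>, the determinant of the
      horizontal block of \<open>e\<close> times the identity minus the rotation.\<close>
    have "2 * e * (e - cos t) * a$1 = 0" "2 * e * (e - cos t) * a$2 = 0"
      using E sc e by algebra+
    moreover have "e \<noteq> 0"
      using e by auto
    ultimately show "(cos t = e \<or> a$1 = 0 \<and> a$2 = 0) \<and> (e = 1 \<or> a$3 = 0)"
      using L by (auto simp: eq)
  next
    assume "(cos t = e \<or> a$1 = 0 \<and> a$2 = 0) \<and> (e = 1 \<or> a$3 = 0)"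
    moreover have "sin t = 0" if "cos t = e"
      using sc e that by simp
    ultimately show "rot e3 t *v a = e *\<^sub>R a"
      by (auto simp: eq)
  qed
qed

lemma rotoreflection_power_simps:
  assumes "n \<ge> 1"
  shows "rotoreflection_power n 0 = mat 1"
    and "rotoreflection_power n n = (- 1) ^ n *\<^sub>R rot e3 pi"
  using assms
  by (simp_all add: rotoreflection_power_def vec_eq_iff forall_3 rot_e3_nth mat_def)

text \<open>The two cases of \<open>Zcal\<close> are one family: the group of order two generated by \<open>(- 1) ^ n *\<^sub>R rot e3 pi\<close>,
  which for \<open>n \<ge> 1\<close> is the \<open>n\<close>-th power of the rotoreflection.\<close>

lemma Zcal_eq: "Zcal n = conj_class {mat 1, (- 1) ^ n *\<^sub>R rot e3 pi}"
proof -
  have "{..<2::nat} = {0, 1}" "{..<1::nat} = {0}"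
    by auto
  moreover have "rot e3 0 = mat 1"
    by (simp add: vec_eq_iff forall_3 rot_e3_nth mat_def)
  moreover have "Zrot 2 = (\<lambda>j. rot e3 (2 * real j * pi / real 2)) ` {..<2}"
    by (auto simp: Zrot_def)
  moreover have "Zminus 1 = rotoreflection_power 1 ` {0, 1}"
    using Zminus_eq[of 1] calculation(1) by simp
  ultimately show ?thesis
    using rotoreflection_power_simps[of 1] by (simp add: Zcal_def minus_one_power_iff)
qed

section \<open>Intersections with the conjugates\<close>

text \<open>The determinant fixes the sign here: if \<open>A = s *\<^sub>R R\<close> with a sign \<open>s\<close> and a rotation \<open>R\<close>, then
  \<open>det A = s\<close>, so the condition on \<open>A\<close> becomes that \<open>R\<close> fixes \<open>a\<close>. A half-turn \<open>R\<close> about \<open>e3\<close>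
  reverses horizontal vectors and is therefore excluded for horizontal \<open>a\<close>, in contrast to the case
  of \<open>O2\<close>.\<close>

lemma Zminus_Int_conj_SO2:
  assumes n: "n \<ge> 1" and g: "g \<in> O3"
  defines "a \<equiv> g *v e3"
  shows "Zminus n \<inter> conj_by g (plus_Zc2 SO2)
    = (if a$1 = 0 \<and> a$2 = 0 then Zminus n else trivial_group)"
proof -
  have "rotoreflection_power n k *v a = det (rotoreflection_power n k) *\<^sub>R a
    \<longleftrightarrow> k = 0 \<or> a$1 = 0 \<and> a$2 = 0" if "k < 2 * n" for k
    using rot_e3_eigenvector_iff[of 1 "real k * pi / real n" a] cos_eq_1_angle_iff[OF n that]
    by (simp add: rotoreflection_power_def minus_one_power_iff uminus_matrix_vector det_uminus_3
        det_rot_e3)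
  then have K: "{k \<in> {..<2 * n}. rotoreflection_power n k *v a = det (rotoreflection_power n k) *\<^sub>R a}
      = (if a$1 = 0 \<and> a$2 = 0 then {..<2 * n} else {0})"
    using n by auto
  have "Zminus n \<inter> conj_by g (plus_Zc2 SO2) = {A \<in> Zminus n. A *v a = det A *\<^sub>R a}"
    using Zminus_subset_O3[OF n] unfolding conj_plus_Zc2_SO2_eq[OF g] a_def by blast
  also have "\<dots> = rotoreflection_power n `
      {k \<in> {..<2 * n}. rotoreflection_power n k *v a = det (rotoreflection_power n k) *\<^sub>R a}"
    unfolding Zminus_eq[OF n] by blast
  finally show ?thesis
    unfolding K by (simp add: Zminus_eq[OF n] trivial_group_def rotoreflection_power_simps[OF n])
qed

lemma Zminus_Int_conj_O2:
  assumes n: "n \<ge> 1" and g: "g \<in> O3"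
  defines "a \<equiv> g *v e3"
  shows "Zminus n \<inter> conj_by g (plus_Zc2 O2)
    = (if a$1 = 0 \<and> a$2 = 0 then Zminus n
       else if a$3 = 0 then {mat 1, (- 1) ^ n *\<^sub>R rot e3 pi}
       else trivial_group)"
proof -
  have "rotoreflection_power n k *v a = a \<or> rotoreflection_power n k *v a = - a
    \<longleftrightarrow> (a$1 = 0 \<and> a$2 = 0) \<or> k = 0 \<or> a$3 = 0 \<and> k = n" if k: "k < 2 * n" for k
  proof -
    let ?R = "rot e3 (real k * pi / real n)"
    have "rotoreflection_power n k *v a = ?R *v a \<or> rotoreflection_power n k *v a = - (?R *v a)"
      by (simp add: rotoreflection_power_def minus_one_power_iff uminus_matrix_vector)
    then have "rotoreflection_power n k *v a = a \<or> rotoreflection_power n k *v a = - a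
        \<longleftrightarrow> ?R *v a = a \<or> ?R *v a = - a"
      by (metis minus_minus)
    also have "\<dots> \<longleftrightarrow> (k = 0 \<or> a$1 = 0 \<and> a$2 = 0) \<or> (k = n \<or> a$1 = 0 \<and> a$2 = 0) \<and> a$3 = 0"
      using rot_e3_eigenvector_iff[of 1 "real k * pi / real n" a] cos_eq_1_angle_iff[OF n k]
        rot_e3_eigenvector_iff[of "- 1" "real k * pi / real n" a] cos_eq_minus1_angle_iff[OF n k]
      by simp
    finally show ?thesis
      by blast
  qed
  then have "{k \<in> {..<2 * n}. rotoreflection_power n k *v a = a \<or> rotoreflection_power n k *v a = - a}
      = {k \<in> {..<2 * n}. (a$1 = 0 \<and> a$2 = 0) \<or> k = 0 \<or> a$3 = 0 \<and> k = n}"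
    by blast
  also have "\<dots> = (if a$1 = 0 \<and> a$2 = 0 then {..<2 * n} else if a$3 = 0 then {0, n} else {0})"
    using n by auto
  finally have K: "{k \<in> {..<2 * n}. rotoreflection_power n k *v a = a \<or> rotoreflection_power n k *v a = - a}
      = (if a$1 = 0 \<and> a$2 = 0 then {..<2 * n} else if a$3 = 0 then {0, n} else {0})" .
  have "Zminus n \<inter> conj_by g (plus_Zc2 O2) = {A \<in> Zminus n. A *v a = a \<or> A *v a = - a}"
    using Zminus_subset_O3[OF n] unfolding conj_plus_Zc2_O2_eq[OF g] a_def by blast
  also have "\<dots> = rotoreflection_power n `
      {k \<in> {..<2 * n}. rotoreflection_power n k *v a = a \<or> rotoreflection_power n k *v a = - a}"
    unfolding Zminus_eq[OF n] by blast
  finally show ?thesis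
    unfolding K by (simp add: Zminus_eq[OF n] trivial_group_def rotoreflection_power_simps[OF n])
qed

lemma O3_image_e3:
  assumes "norm a = 1"
  obtains g where "g \<in> O3" "g *v e3 = a"
  using orthogonal_matrix_exists_basis[OF assms, of 3] by (auto simp: O3_def)

theorem lemma4p6:
  fixes n :: nat
  assumes "n \<ge> 1"
  shows "conj_class (Zminus n) \<circledcirc> conj_class (plus_Zc2 SO2)
           = {conj_class trivial_group, conj_class (Zminus n)} \<and>
         conj_class (Zminus n) \<circledcirc> conj_class (plus_Zc2 O2)
           = {conj_class trivial_group, Zcal n, conj_class (Zminus n)}"
proof -
  obtain v where v: "v \<in> O3" "v *v e3 = e3"
    by (rule O3_image_e3[of e3]) simp_all
  obtain h where h: "h \<in> O3" "h *v e3 = axis 1 1"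
    by (rule O3_image_e3[of "axis 1 1"]) simp_all
  \<comment> \<open>Any unit vector that is neither horizontal nor vertical serves as \<open>c\<close>.\<close>
  define c :: "real^3" where "c = vector [3/5, 0, 4/5]"
  have "norm c = 1"
    by (simp add: norm_eq_1 inner_vec_def sum_3 c_def)
  then obtain w where w: "w \<in> O3" "w *v e3 = c"
    by (rule O3_image_e3)
  have ax: "e3 $ 1 = 0" "e3 $ 2 = 0" "(axis 1 1 :: real^3) $ 1 = 1" "(axis 1 1 :: real^3) $ 3 = 0"
    "c $ 1 \<noteq> 0" "c $ 3 \<noteq> 0"
    by (simp_all add: axis_def c_def)
  let ?S = "\<lambda>g. conj_class (Zminus n \<inter> conj_by g (plus_Zc2 SO2))"
  let ?O = "\<lambda>g. conj_class (Zminus n \<inter> conj_by g (plus_Zc2 O2))"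
  have S: "?S v = conj_class (Zminus n)" "?S h = conj_class trivial_group"
    using v h ax by (simp_all add: Zminus_Int_conj_SO2[OF assms])
  have O: "?O v = conj_class (Zminus n)" "?O h = Zcal n" "?O w = conj_class trivial_group"
    using v h w ax by (simp_all add: Zminus_Int_conj_O2[OF assms] Zcal_eq)
  have "?S g \<in> {conj_class trivial_group, conj_class (Zminus n)}" if "g \<in> O3" for g
    using that by (simp add: Zminus_Int_conj_SO2[OF assms])
  then have "{?S g | g. g \<in> O3} = {conj_class trivial_group, conj_class (Zminus n)}"
    using S[symmetric] v(1) h(1) by blast
  moreover have "?O g \<in> {conj_class trivial_group, Zcal n, conj_class (Zminus n)}"
    if "g \<in> O3" for g
    using that by (simp add: Zminus_Int_conj_O2[OF assms] Zcal_eq)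
  then have "{?O g | g. g \<in> O3} = {conj_class trivial_group, Zcal n, conj_class (Zminus n)}"
    using O[symmetric] v(1) h(1) w(1) by blast
  ultimately show ?thesis
    by (simp add: clips_conj_class)
qed

end
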